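(* Let $m\ge 1$ and let $x_1,\dots,x_m,y_1,\dots,y_m$ be complex numbers with $1+x_iy_j\ne 0$, $1+x_i\neq 0$, $1+y_j\neq 0$ for all $i,j\in\{1,\dots,m\}$. Let $W_m(\vec x,\vec y)$ be the $(m+1)\times(m+1)$ matrix with rows and columns indexed by $0,\dots,m$, whose $(0,0)$ entry is $0$, whose other entries in row $0$ and column $0$ are all $1$, and whose $(i,j)$ entry is $\frac{x_i+y_j}{1+x_iy_j}$ for $1\le i,j\le m$. Then $$\det W_m(\vec x,\vec y)=-\frac12\Bigl(\prod_{i=1}^{m}(1+x_i)\prod_{j=1}^{m}(1+y_j)-(-1)^m\prod_{i=1}^{m}(1-x_i)\prod_{j=1}^{m}(1-y_j)\Bigr)\prod_{1\le i<j\le m}(x_i-x_j)\prod_{1\le i<j\le m}(y_j-y_i)\prod_{i=1}^{m}\prod_{j=1}^{m}(1+x_iy_j)^{-1}.$$ *)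

theory Defs
  imports Complex_Main "Jordan_Normal_Form.Determinant"
begin

definition W_mat :: "nat \<Rightarrow> (nat \<Rightarrow> complex) \<Rightarrow> (nat \<Rightarrow> complex) \<Rightarrow> complex mat" where
  "W_mat m x y = mat (m + 1) (m + 1) (\<lambda>(i, j).
     if i = 0 \<and> j = 0 then 0
     else if i = 0 \<or> j = 0 then 1
     else (x i + y j) / (1 + x i * y j))"

end

theory Submission
  imports Defs
begin

text \<open>Write \<open>W\<close> for the inner \<open>m \<times> m\<close> block and \<open>J\<close> for the all-ones matrix. A Schur complement
  shows that \<open>det (W + s J)\<close> is affine in \<open>s\<close> with slope minus the bordered determinant, so the
  bordered determinant is \<open>(det (W - J) - det (W + J)) / 2\<close>. Since
  \<open>(x + y) / (1 + x y) \<plusminus> 1 = \<plusminus> (1 \<plusminus> x) (1 \<plusminus> y) / (1 + x y)\<close>, both of these are row and column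
  rescalings of the Cauchy determinant \<open>det (1 / (1 + x\<^sub>i y\<^sub>j))\<close>.\<close>

text \<open>In the Leibniz expansion every permutation meets each row and each column exactly once,
  so all row and column factors come out of every summand alike.\<close>

lemma det_mat_scale_rows_cols:
  fixes f :: "nat \<Rightarrow> nat \<Rightarrow> 'a :: comm_ring_1"
  shows "det (mat n n (\<lambda>(i, j). r i * c j * f i j)) =
    (\<Prod>i<n. r i) * (\<Prod>j<n. c j) * det (mat n n (\<lambda>(i, j). f i j))"
proof -
  have perm: "(\<Prod>i = 0..<n. r i * c (p i) * f i (p i)) =
      (\<Prod>i<n. r i) * (\<Prod>j<n. c j) * (\<Prod>i = 0..<n. f i (p i))"
    if "p permutes {0..<n}" for p
    using prod.permute[OF that, of c] by (simp add: prod.distrib o_def atLeast0LessThan)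
  have "det (mat n n (\<lambda>(i, j). r i * c j * f i j)) =
      (\<Sum>p | p permutes {0..<n}. signof p * (\<Prod>i = 0..<n. r i * c (p i) * f i (p i)))"
    by (auto simp: det_def intro!: sum.cong)
  also have "\<dots> = (\<Sum>p | p permutes {0..<n}. (\<Prod>i<n. r i) * (\<Prod>j<n. c j) *
      (signof p * (\<Prod>i = 0..<n. f i (p i))))"
  proof (rule sum.cong[OF refl])
    fix p assume "p \<in> {p. p permutes {0..<n}}"
    then have "p permutes {0..<n}"
      by simp
    from perm[OF this] show "signof p * (\<Prod>i = 0..<n. r i * c (p i) * f i (p i)) =
        (\<Prod>i<n. r i) * (\<Prod>j<n. c j) * (signof p * (\<Prod>i = 0..<n. f i (p i)))"
      by (simp only: mult_ac)
  qed
  also have "\<dots> = (\<Prod>i<n. r i) * (\<Prod>j<n. c j) * det (mat n n (\<lambda>(i, j). f i j))"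
    unfolding sum_distrib_left[symmetric]
    by (auto simp: det_def intro!: sum.cong arg_cong2[where f = "(*)"])
  finally show ?thesis .
qed

text \<open>One step of Gaussian elimination, written as a factorization \<open>L * U\<close>:
  \<open>L\<close> is unit lower triangular, and the trailing block of \<open>U\<close> is the Schur
  complement of the pivot \<open>f 0 0\<close>.\<close>

lemma det_mat_pivot:
  fixes f :: "nat \<Rightarrow> nat \<Rightarrow> 'a :: field"
  assumes "f 0 0 \<noteq> 0"
  shows "det (mat (Suc n) (Suc n) (\<lambda>(i, j). f i j)) =
    f 0 0 * det (mat n n (\<lambda>(i, j). f (Suc i) (Suc j) - f (Suc i) 0 * f 0 (Suc j) / f 0 0))"
proof -
  let ?A = "mat (Suc n) (Suc n) (\<lambda>(i, j). f i j)"
  let ?S = "mat n n (\<lambda>(i, j). f (Suc i) (Suc j) - f (Suc i) 0 * f 0 (Suc j) / f 0 0)"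
  define L where "L = mat (Suc n) (Suc n) (\<lambda>(i, j). if i = j then 1 else if j = 0 then f i 0 / f 0 0 else 0)"
  \<comment> \<open>For \<open>i > 0\<close> and \<open>j = 0\<close> the formula gives
    \<open>f i 0 - f i 0 * f 0 0 / f 0 0 = 0\<close>, so column 0 of \<open>U\<close> vanishes below
    the pivot and its Laplace expansion has a single term.\<close>
  define U where "U = mat (Suc n) (Suc n) (\<lambda>(i, j). if i = 0 then f 0 j else f i j - f i 0 * f 0 j / f 0 0)"
  have "?A = L * U"
  proof (rule eq_matI)
    fix i j assume "i < dim_row (L * U)" "j < dim_col (L * U)"
    then have ij: "i < Suc n" "j < Suc n"
      by (simp_all add: L_def U_def)
    then have "(L * U) $$ (i, j) =
        (\<Sum>k<Suc n. (if i = k then 1 else if k = 0 then f i 0 / f 0 0 else 0) *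
           (if k = 0 then f 0 j else f k j - f k 0 * f 0 j / f 0 0))"
      by (simp add: L_def U_def scalar_prod_def atLeast0LessThan del: sum.lessThan_Suc)
    \<comment> \<open>Row \<open>i\<close> of \<open>L\<close> is supported on columns 0 and
      \<open>i\<close>; for \<open>i = 0\<close> these coincide.\<close>
    also have "\<dots> = (\<Sum>k\<in>{0, i}. (if i = k then 1 else if k = 0 then f i 0 / f 0 0 else 0) *
           (if k = 0 then f 0 j else f k j - f k 0 * f 0 j / f 0 0))"
      using ij by (intro sum.mono_neutral_right) auto
    also have "\<dots> = f i j"
      using assms by (cases "i = 0") auto
    finally show "?A $$ (i, j) = (L * U) $$ (i, j)"
      using ij by simp
  qed (simp_all add: L_def U_def)
  moreover have "det L = 1"
  proof -
    have "det L = prod_list (diag_mat L)"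
      by (rule det_lower_triangular[of "Suc n"]) (auto simp: L_def)
    also have "diag_mat L = replicate (Suc n) 1"
      by (rule nth_equalityI) (auto simp: diag_mat_def L_def simp del: replicate.simps upt_Suc)
    finally show ?thesis by simp
  qed
  moreover have "det U = f 0 0 * det ?S"
  proof -
    have "det U = (\<Sum>i<Suc n. U $$ (i, 0) * cofactor U i 0)"
      by (rule laplace_expansion_column) (auto simp: U_def)
    also have "\<dots> = (\<Sum>i\<in>{0}. U $$ (i, 0) * cofactor U i 0)"
      using assms by (intro sum.mono_neutral_right) (auto simp: U_def)
    also have "mat_delete U 0 0 = ?S"
      by (rule eq_matI) (auto simp: mat_delete_def U_def)
    then have "(\<Sum>i\<in>{0}. U $$ (i, 0) * cofactor U i 0) = f 0 0 * det ?S"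
      by (simp add: cofactor_def U_def)
    finally show ?thesis .
  qed
  ultimately show ?thesis
    using det_mult[of L "Suc n" U] by (simp add: L_def U_def)
qed

lemma prod_lessThan_square_Suc:
  fixes f :: "nat \<Rightarrow> nat \<Rightarrow> 'a :: comm_monoid_mult"
  shows "(\<Prod>i<Suc n. \<Prod>j<Suc n. f i j) =
    f 0 0 * (\<Prod>i<n. f (Suc i) 0) * (\<Prod>j<n. f 0 (Suc j)) * (\<Prod>i<n. \<Prod>j<n. f (Suc i) (Suc j))"
  by (simp add: prod.lessThan_Suc_shift prod.distrib mult_ac del: prod.lessThan_Suc)

lemma prod_strict_upper_Suc:
  fixes f :: "nat \<Rightarrow> nat \<Rightarrow> 'a :: comm_monoid_mult"
  shows "(\<Prod>i<Suc n. \<Prod>j\<in>{i<..<Suc n}. f i j) =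
    (\<Prod>j<n. f 0 (Suc j)) * (\<Prod>i<n. \<Prod>j\<in>{i<..<n}. f (Suc i) (Suc j))"
proof -
  have "(\<Prod>j\<in>{Suc i<..<Suc n}. f (Suc i) j) = (\<Prod>j\<in>{i<..<n}. f (Suc i) (Suc j))" for i
    by (rule prod.reindex_bij_witness[of _ Suc "\<lambda>j. j - 1"]) auto
  moreover have "(\<Prod>j\<in>{0<..<Suc n}. f 0 j) = (\<Prod>j<n. f 0 (Suc j))"
    by (rule prod.reindex_bij_witness[of _ Suc "\<lambda>j. j - 1"]) auto
  ultimately show ?thesis
    by (simp add: prod.lessThan_Suc_shift del: prod.lessThan_Suc)
qed

text \<open>Induction on \<open>n\<close>: pivoting at (0,0) leaves a matrix of the same shape in
  the shifted parameters, up to row and column factors. These factors and the pivot are exactly what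
  index 0 contributes to the three products.\<close>

lemma det_cauchy:
  fixes a b :: "nat \<Rightarrow> 'a :: field"
  assumes "\<And>i j. i < n \<Longrightarrow> j < n \<Longrightarrow> 1 + a i * b j \<noteq> 0"
  shows "det (mat n n (\<lambda>(i, j). inverse (1 + a i * b j))) =
    (\<Prod>i<n. \<Prod>j\<in>{i<..<n}. a i - a j) * (\<Prod>i<n. \<Prod>j\<in>{i<..<n}. b j - b i) *
    (\<Prod>i<n. \<Prod>j<n. inverse (1 + a i * b j))"
  using assms
proof (induction n arbitrary: a b)
  case 0
  then show ?case by simp
next
  case (Suc n)
  let ?q = "\<lambda>i j. inverse (1 + a i * b j)"
  \<comment> \<open>With a, b, a', b' for \<open>a 0\<close>, \<open>b 0\<close>,
    \<open>a (Suc i)\<close>, \<open>b (Suc j)\<close>, the numerator over the common denominator is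
    (1 + a' b)(1 + a b') - (1 + a b)(1 + a' b') = (a - a')(b' - b).\<close>
  have schur: "?q (Suc i) (Suc j) - ?q (Suc i) 0 * ?q 0 (Suc j) / ?q 0 0 =
      ((a 0 - a (Suc i)) * ?q (Suc i) 0) * ((b (Suc j) - b 0) * ?q 0 (Suc j)) * ?q (Suc i) (Suc j)"
    if "i < n" "j < n" for i j
  proof -
    have "1 + a (Suc i) * b (Suc j) \<noteq> 0" "1 + a (Suc i) * b 0 \<noteq> 0"
      "1 + a 0 * b (Suc j) \<noteq> 0" "1 + a 0 * b 0 \<noteq> 0"
      using that Suc.prems[of "Suc i" "Suc j"] Suc.prems[of "Suc i" 0] Suc.prems[of 0 "Suc j"] Suc.prems[of 0 0]
      by auto
    then show ?thesis
      by (simp add: divide_simps) (simp add: algebra_simps)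
  qed
  have "det (mat (Suc n) (Suc n) (\<lambda>(i, j). ?q i j)) =
      ?q 0 0 * det (mat n n (\<lambda>(i, j). ?q (Suc i) (Suc j) - ?q (Suc i) 0 * ?q 0 (Suc j) / ?q 0 0))"
    using Suc.prems[of 0 0] by (intro det_mat_pivot) auto
  also have "mat n n (\<lambda>(i, j). ?q (Suc i) (Suc j) - ?q (Suc i) 0 * ?q 0 (Suc j) / ?q 0 0) =
      mat n n (\<lambda>(i, j). ((a 0 - a (Suc i)) * ?q (Suc i) 0) * ((b (Suc j) - b 0) * ?q 0 (Suc j)) *
        ?q (Suc i) (Suc j))"
    by (intro cong_mat) (auto simp: schur)
  also have "det \<dots> = (\<Prod>i<n. (a 0 - a (Suc i)) * ?q (Suc i) 0) *
      (\<Prod>j<n. (b (Suc j) - b 0) * ?q 0 (Suc j)) * det (mat n n (\<lambda>(i, j). ?q (Suc i) (Suc j)))"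
    by (rule det_mat_scale_rows_cols)
  also have "det (mat n n (\<lambda>(i, j). ?q (Suc i) (Suc j))) =
      (\<Prod>i<n. \<Prod>j\<in>{i<..<n}. a (Suc i) - a (Suc j)) * (\<Prod>i<n. \<Prod>j\<in>{i<..<n}. b (Suc j) - b (Suc i)) *
      (\<Prod>i<n. \<Prod>j<n. ?q (Suc i) (Suc j))"
    using Suc.prems by (intro Suc.IH) auto
  finally show ?case
    unfolding prod_strict_upper_Suc prod_lessThan_square_Suc by (simp add: prod.distrib mult_ac)
qed

text \<open>Expand along column 0: \<open>t\<close> occurs only as the coefficient of the corner
  cofactor, and the cofactors themselves do not see that column.\<close>

lemma det_bordered_corner:
  fixes w :: "nat \<Rightarrow> nat \<Rightarrow> 'a :: comm_ring_1" and n :: nat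
  defines "B \<equiv> \<lambda>t. mat (Suc n) (Suc n) (\<lambda>(i, j).
     if i = 0 \<and> j = 0 then t else if i = 0 \<or> j = 0 then 1 else w (i - 1) (j - 1))"
  shows "det (B t) = det (B 0) + t * det (mat n n (\<lambda>(i, j). w i j))"
proof -
  have expand: "det (B s) = s * cofactor (B s) 0 0 + (\<Sum>i<n. cofactor (B s) (Suc i) 0)" for s
  proof -
    have "det (B s) = (\<Sum>i<Suc n. B s $$ (i, 0) * cofactor (B s) i 0)"
      by (rule laplace_expansion_column) (auto simp: B_def)
    then show ?thesis
      by (simp add: sum.lessThan_Suc_shift B_def del: sum.lessThan_Suc)
  qed
  have "mat_delete (B s) i 0 = mat_delete (B 0) i 0" for i s
    by (rule eq_matI) (auto simp: mat_delete_def B_def)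
  then have cof: "cofactor (B s) i 0 = cofactor (B 0) i 0" for i s
    by (metis cofactor_def)
  have "mat_delete (B 0) 0 0 = mat n n (\<lambda>(i, j). w i j)"
    by (rule eq_matI) (auto simp: mat_delete_def B_def)
  then have "cofactor (B 0) 0 0 = det (mat n n (\<lambda>(i, j). w i j))"
    by (simp add: cofactor_def)
  then show ?thesis
    using expand[of t] expand[of 0] cof[of t] by simp
qed

text \<open>A zero corner cannot serve as pivot, so the corner is set to 1 and to -1. A corner
  \<open>t\<close> has Schur complement \<open>w i j - 1 / t\<close>, which yields the two shifted
  matrices.\<close>

lemma two_det_bordered:
  fixes w :: "nat \<Rightarrow> nat \<Rightarrow> 'a :: field"
  shows "2 * det (mat (Suc n) (Suc n) (\<lambda>(i, j).
      if i = 0 \<and> j = 0 then 0 else if i = 0 \<or> j = 0 then 1 else w (i - 1) (j - 1))) =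
    det (mat n n (\<lambda>(i, j). w i j - 1)) - det (mat n n (\<lambda>(i, j). w i j + 1))"
proof -
  let ?f = "\<lambda>t i j. if i = 0 \<and> j = 0 then t else if i = 0 \<or> j = 0 then 1 else w (i - 1) (j - 1)"
  let ?B = "\<lambda>t. mat (Suc n) (Suc n) (\<lambda>(i, j). ?f t i j)"
  have "det (?B 1) = det (mat n n (\<lambda>(i, j). w i j - 1))"
    using det_mat_pivot[of "?f 1" n] by simp
  moreover have "det (?B (- 1)) = - det (mat n n (\<lambda>(i, j). w i j + 1))"
    using det_mat_pivot[of "?f (- 1)" n] by simp
  ultimately have eqs:
    "det (?B 0) + det (mat n n (\<lambda>(i, j). w i j)) = det (mat n n (\<lambda>(i, j). w i j - 1))"
    "det (?B 0) - det (mat n n (\<lambda>(i, j). w i j)) = - det (mat n n (\<lambda>(i, j). w i j + 1))"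
    using det_bordered_corner[of n 1 w] det_bordered_corner[of n "- 1" w] by simp_all
  \<comment> \<open>The corners 1 and -1 are opposite, so adding the two equations cancels the
    determinant of \<open>w\<close>.\<close>
  have "2 * det (?B 0) = (det (?B 0) + det (mat n n (\<lambda>(i, j). w i j))) +
      (det (?B 0) - det (mat n n (\<lambda>(i, j). w i j)))"
    by (simp add: algebra_simps)
  then show ?thesis
    unfolding eqs by (simp only: diff_conv_add_uminus)
qed

theorem theorem4:
  fixes m :: nat and x y :: "nat \<Rightarrow> complex"
  assumes "m \<ge> 1"
    and "\<And>i j. i \<in> {1..m} \<Longrightarrow> j \<in> {1..m} \<Longrightarrow> 1 + x i * y j \<noteq> 0"
    and "\<And>i. i \<in> {1..m} \<Longrightarrow> 1 + x i \<noteq> 0"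
    and "\<And>j. j \<in> {1..m} \<Longrightarrow> 1 + y j \<noteq> 0"
  shows "det (W_mat m x y) =
    - (1 / 2) * ((\<Prod>i=1..m. 1 + x i) * (\<Prod>j=1..m. 1 + y j)
                 - (- 1) ^ m * (\<Prod>i=1..m. 1 - x i) * (\<Prod>j=1..m. 1 - y j))
    * (\<Prod>i=1..m. \<Prod>j=i+1..m. x i - x j)
    * (\<Prod>i=1..m. \<Prod>j=i+1..m. y j - y i)
    * (\<Prod>i=1..m. \<Prod>j=1..m. inverse (1 + x i * y j))"
proof -
  \<comment> \<open>Index 0 of \<open>W_mat\<close> is the border, so the inner block is reindexed
    from 1..m to 0..m-1 to fit the lemmas above.\<close>
  let ?x = "\<lambda>i. x (Suc i)" and ?y = "\<lambda>j. y (Suc j)"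
  let ?w = "\<lambda>i j. (?x i + ?y j) / (1 + ?x i * ?y j)"
  let ?C = "det (mat m m (\<lambda>(i, j). inverse (1 + ?x i * ?y j)))"
  have nz: "1 + ?x i * ?y j \<noteq> 0" if "i < m" "j < m" for i j
    using assms(2)[of "Suc i" "Suc j"] that by simp
  have shift: "(\<Prod>i=1..m. g i) = (\<Prod>i<m. g (Suc i))" for g :: "nat \<Rightarrow> complex"
    by (rule prod.reindex_bij_witness[of _ Suc "\<lambda>i. i - 1"]) auto
  have shift_upper: "(\<Prod>i=1..m. \<Prod>j=i+1..m. g i j) = (\<Prod>i<m. \<Prod>j\<in>{i<..<m}. g (Suc i) (Suc j))"
    for g :: "nat \<Rightarrow> nat \<Rightarrow> complex"
  proof -
    have "(\<Prod>j=Suc i+1..m. g (Suc i) j) = (\<Prod>j\<in>{i<..<m}. g (Suc i) (Suc j))" for i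
      by (rule prod.reindex_bij_witness[of _ Suc "\<lambda>j. j - 1"]) auto
    then show ?thesis
      unfolding shift by simp
  qed
  \<comment> \<open>The sign is attached to the row factor, so that extracting it from all
    \<open>m\<close> rows produces \<open>(- 1) ^ m\<close>.\<close>
  have "mat m m (\<lambda>(i, j). ?w i j - 1) =
      mat m m (\<lambda>(i, j). (- 1 * (1 - ?x i)) * (1 - ?y j) * inverse (1 + ?x i * ?y j))"
    using nz by (intro cong_mat) (auto simp: field_simps)
  then have minus: "det (mat m m (\<lambda>(i, j). ?w i j - 1)) =
      (- 1) ^ m * (\<Prod>i<m. 1 - ?x i) * (\<Prod>j<m. 1 - ?y j) * ?C"
    by (simp only: det_mat_scale_rows_cols prod.distrib prod_constant card_lessThan)
  have "mat m m (\<lambda>(i, j). ?w i j + 1) =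
      mat m m (\<lambda>(i, j). (1 + ?x i) * (1 + ?y j) * inverse (1 + ?x i * ?y j))"
    using nz by (intro cong_mat) (auto simp: field_simps)
  then have plus: "det (mat m m (\<lambda>(i, j). ?w i j + 1)) =
      (\<Prod>i<m. 1 + ?x i) * (\<Prod>j<m. 1 + ?y j) * ?C"
    by (simp only: det_mat_scale_rows_cols)
  have "W_mat m x y = mat (Suc m) (Suc m) (\<lambda>(i, j).
      if i = 0 \<and> j = 0 then 0 else if i = 0 \<or> j = 0 then 1 else ?w (i - 1) (j - 1))"
    unfolding W_mat_def by (intro cong_mat) auto
  then have "2 * det (W_mat m x y) =
      ((- 1) ^ m * (\<Prod>i<m. 1 - ?x i) * (\<Prod>j<m. 1 - ?y j) - (\<Prod>i<m. 1 + ?x i) * (\<Prod>j<m. 1 + ?y j)) * ?C"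
    using two_det_bordered[of m ?w] unfolding plus minus by (simp only: left_diff_distrib)
  then have "det (W_mat m x y) = - (1 / 2) * ((\<Prod>i<m. 1 + ?x i) * (\<Prod>j<m. 1 + ?y j)
      - (- 1) ^ m * (\<Prod>i<m. 1 - ?x i) * (\<Prod>j<m. 1 - ?y j)) * ?C"
    by (simp add: field_simps)
  also have "?C = (\<Prod>i<m. \<Prod>j\<in>{i<..<m}. ?x i - ?x j) * (\<Prod>i<m. \<Prod>j\<in>{i<..<m}. ?y j - ?y i) *
      (\<Prod>i<m. \<Prod>j<m. inverse (1 + ?x i * ?y j))"
    using nz by (rule det_cauchy)
  finally show ?thesis
    unfolding shift_upper shift by (simp only: mult.assoc)
qed

end
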